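(* Let $n\ge 2$ be an integer and let $S_n=K_{1,n-1}$ be the star graph on $n$ vertices. Then: (i) the Randić characteristic polynomial of $S_n$ is $RP(S_n,\lambda)=\lambda^{n-2}(\lambda^2-1)$; (ii) the Randić energy of $S_n$ is $RE(S_n)=2$.
   Context: All graphs are finite and simple. For a graph $G$ with vertices $v_1,\dots,v_n$ of degrees $d_1,\dots,d_n$, the Randić matrix $R(G)$ is the $n\times n$ real symmetric matrix with $(i,j)$-entry $\frac{1}{\sqrt{d_id_j}}$ if $v_i$ and $v_j$ are adjacent, and $0$ otherwise. The Randić characteristic polynomial of $G$ is $RP(G,\lambda)=\det(\lambda I-R(G))$. The Randić energy of $G$ is $RE(G)=\sum_{i=1}^n|\rho_i|$, where $\rho_1,\dots,\rho_n$ are the eigenvalues of $R(G)$ counted with multiplicity. *)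

theory Defs
  imports "Jordan_Normal_Form.Char_Poly" "Graph_Theory.Kuratowski"
begin

text \<open>
  Graphs are finite simple graphs in the sense of the locale \<^locale>\<open>graph\<close>: symmetric, loop-free
  digraphs without parallel arcs, so that every undirected edge is a pair of opposite arcs and the
  degree of a vertex is its out-degree. The list \<open>vs\<close> is an enumeration \<open>v\<^sub>1, \<dots>, v\<^sub>n\<close> of
  the vertices, which fixes the order of rows and columns.
\<close>

definition randic_matrix :: "('a, 'b) pre_digraph \<Rightarrow> 'a list \<Rightarrow> real mat" where
  "randic_matrix G vs = mat (length vs) (length vs) (\<lambda>(i, j).
     if vs ! i \<rightarrow>\<^bsub>G\<^esub> vs ! j
     then 1 / sqrt (real (out_degree G (vs ! i)) * real (out_degree G (vs ! j)))
     else 0)"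

definition randic_char_poly :: "('a, 'b) pre_digraph \<Rightarrow> 'a list \<Rightarrow> real poly" where
  "randic_char_poly G vs = char_poly (randic_matrix G vs)"

text \<open>
  The Randic matrix of a graph is real symmetric, so all its eigenvalues are real and it suffices to
  sum over the real ones, each weighted by its multiplicity as a root of the characteristic
  polynomial.
\<close>

definition randic_energy :: "('a, 'b) pre_digraph \<Rightarrow> 'a list \<Rightarrow> real" where
  "randic_energy G vs =
     (\<Sum>\<rho> | eigenvalue (randic_matrix G vs) \<rho>. real (order \<rho> (randic_char_poly G vs)) * \<bar>\<rho>\<bar>)"

definition star_graph :: "nat \<Rightarrow> ('a, 'b) pre_digraph \<Rightarrow> bool" where
  "star_graph n G \<longleftrightarrow> K\<^bsub>1,n - 1\<^esub> G"

end

theory Submission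
  imports Defs
begin

text \<open>
  With the centre at index \<open>c\<close>, the Randic matrix has constant entries \<open>a = 1 / \<surd>(n - 1)\<close> off the
  diagonal in row and column \<open>c\<close>, and zeros elsewhere. Multiplying \<open>\<lambda>I - R\<close> from the right by
  the identity matrix whose column \<open>c\<close> is replaced by \<open>\<lambda>\<close> (at \<open>c\<close>) and \<open>a\<close> (elsewhere), a matrix of
  determinant \<open>\<lambda>\<close>, clears column \<open>c\<close> except for the entry \<open>\<lambda>\<^sup>2 - (n - 1) a\<^sup>2\<close> on the diagonal.
  Expanding along that column gives \<open>\<lambda> det (\<lambda>I - R) = (\<lambda>\<^sup>2 - (n - 1) a\<^sup>2) \<lambda>\<^bsup>n - 1\<^esup>\<close>.
\<close>

lemma det_column_single_entry:
  fixes A :: "'a :: comm_ring_1 mat"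
  assumes A: "A \<in> carrier_mat n n" and c: "c < n"
    and zero: "\<And>i. i < n \<Longrightarrow> i \<noteq> c \<Longrightarrow> A $$ (i, c) = 0"
  shows "det A = A $$ (c, c) * det (mat_delete A c c)"
proof -
  have "det A = (\<Sum>i<n. A $$ (i, c) * cofactor A i c)"
    by (rule laplace_expansion_column[OF A c])
  also have "\<dots> = (\<Sum>i\<in>{c}. A $$ (i, c) * cofactor A i c)"
    using c zero by (intro sum.mono_neutral_right) auto
  finally show ?thesis
    by (simp add: cofactor_def)
qed

lemma det_row_single_entry:
  fixes A :: "'a :: comm_ring_1 mat"
  assumes A: "A \<in> carrier_mat n n" and c: "c < n"
    and zero: "\<And>j. j < n \<Longrightarrow> j \<noteq> c \<Longrightarrow> A $$ (c, j) = 0"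
  shows "det A = A $$ (c, c) * det (mat_delete A c c)"
proof -
  have "det A = (\<Sum>j<n. A $$ (c, j) * cofactor A c j)"
    by (rule laplace_expansion_row[OF A c])
  also have "\<dots> = (\<Sum>j\<in>{c}. A $$ (c, j) * cofactor A c j)"
    using c zero by (intro sum.mono_neutral_right) auto
  finally show ?thesis
    by (simp add: cofactor_def)
qed

text \<open>Weighted adjacency matrix of a star. The centre index \<open>c\<close> stays arbitrary
  because the enumeration of the vertices may put the centre anywhere. The inequality of truth
  values is exclusive or, so the entry at \<open>(c, c)\<close> is zero.\<close>

definition star_mat :: "nat \<Rightarrow> nat \<Rightarrow> 'a \<Rightarrow> 'a :: zero mat" where
  "star_mat n c a = mat n n (\<lambda>(i, j). if (i = c) \<noteq> (j = c) then a else 0)"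

lemma char_poly_star_mat:
  fixes a :: "'a :: idom"
  assumes n: "n \<ge> 2" and c: "c < n"
  shows "char_poly (star_mat n c a) = [:0, 1:] ^ (n - 2) * ([:0, 1:] ^ 2 - [:of_nat (n - 1) * a\<^sup>2:])"
proof -
  let ?x = "[:0, 1:] :: 'a poly"
  define P where "P = char_poly_matrix (star_mat n c a)"
  define Q where "Q = mat n n (\<lambda>(i, j). if j = c then (if i = c then ?x else [:a:])
                                       else if i = j then 1 else 0)"
  have P: "P \<in> carrier_mat n n" and Q: "Q \<in> carrier_mat n n"
    by (auto simp: P_def Q_def star_mat_def)
  have P_entry: "P $$ (i, j) = (if i = j then ?x else if (i = c) \<noteq> (j = c) then [:- a:] else 0)"
    if "i < n" "j < n" for i j
    using that by (auto simp: P_def char_poly_matrix_def star_mat_def)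
  have PQ_entry: "(P * Q) $$ (i, j) = (\<Sum>k<n. P $$ (i, k) * Q $$ (k, j))" if "i < n" "j < n" for i j
    using that P Q by (simp add: scalar_prod_def lessThan_atLeast0)
  \<comment> \<open>Outside column \<open>c\<close>, the columns of \<open>Q\<close> are unit
    vectors.\<close>
  have PQ_other: "(P * Q) $$ (i, j) = P $$ (i, j)" if "i < n" "j < n" "j \<noteq> c" for i j
  proof -
    have "(\<Sum>k<n. P $$ (i, k) * Q $$ (k, j)) = (\<Sum>k\<in>{j}. P $$ (i, k) * Q $$ (k, j))"
      using that by (intro sum.mono_neutral_right) (auto simp: Q_def)
    thus ?thesis
      using that by (simp add: PQ_entry) (simp add: Q_def)
  qed
  have PQ_centre: "(P * Q) $$ (c, c) = ?x ^ 2 - [:of_nat (n - 1) * a\<^sup>2:]"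
  proof -
    have "(P * Q) $$ (c, c) = ?x * ?x + (\<Sum>k\<in>{..<n} - {c}. P $$ (c, k) * Q $$ (k, c))"
      using c by (simp add: PQ_entry sum.remove[of _ c]) (simp add: P_entry Q_def)
    also have "(\<Sum>k\<in>{..<n} - {c}. P $$ (c, k) * Q $$ (k, c)) = (\<Sum>k\<in>{..<n} - {c}. [:- a\<^sup>2:])"
      using c by (intro sum.cong) (auto simp: P_entry Q_def power2_eq_square)
    also have "\<dots> = - [:of_nat (n - 1) * a\<^sup>2:]"
      using c by (simp add: of_nat_poly)
    finally show ?thesis
      by (simp add: power2_eq_square)
  qed
  \<comment> \<open>Row \<open>i\<close> of \<open>P\<close> lives on the positions \<open>i\<close>
    and \<open>c\<close> only, and the two products \<open>?x * [:a:]\<close> and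
    \<open>[:- a:] * ?x\<close> cancel. This dictates the entries of \<open>Q\<close>.\<close>
  have PQ_column: "(P * Q) $$ (i, c) = 0" if "i < n" "i \<noteq> c" for i
  proof -
    have "(\<Sum>k<n. P $$ (i, k) * Q $$ (k, c)) = (\<Sum>k\<in>{i, c}. P $$ (i, k) * Q $$ (k, c))"
      using that c by (intro sum.mono_neutral_right) (auto simp: P_entry)
    thus ?thesis
      using that c by (simp add: PQ_entry) (simp add: P_entry Q_def)
  qed
  have "mat_delete (P * Q) c c = ?x \<cdot>\<^sub>m 1\<^sub>m (n - 1)"
  proof (rule eq_matI)
    fix i j assume "i < dim_row (?x \<cdot>\<^sub>m 1\<^sub>m (n - 1))" "j < dim_col (?x \<cdot>\<^sub>m 1\<^sub>m (n - 1))"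
    hence ij: "i < n - 1" "j < n - 1" by auto
    let ?i = "insert_index c i" and ?j = "insert_index c j"
    have ij': "?i < n" "?j < n" "?i \<noteq> c" "?j \<noteq> c" "?i = ?j \<longleftrightarrow> i = j"
      using ij by (auto simp: insert_index_def)
    have "mat_delete (P * Q) c c $$ (i, j) = (P * Q) $$ (?i, ?j)"
      using ij P Q c by (auto simp: mat_delete_def insert_index_def)
    thus "mat_delete (P * Q) c c $$ (i, j) = (?x \<cdot>\<^sub>m 1\<^sub>m (n - 1)) $$ (i, j)"
      using ij ij' by (simp add: PQ_other P_entry)
  qed (use P Q in \<open>auto simp: mat_delete_def\<close>)
  hence det_PQ: "det (P * Q) = (?x ^ 2 - [:of_nat (n - 1) * a\<^sup>2:]) * ?x ^ (n - 1)"
    using P Q c PQ_column PQ_centre by (subst det_column_single_entry[of _ n c]) auto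
  have "mat_delete Q c c = 1\<^sub>m (n - 1)"
  proof (rule eq_matI)
    fix i j assume "i < dim_row (1\<^sub>m (n - 1) :: 'a poly mat)" "j < dim_col (1\<^sub>m (n - 1) :: 'a poly mat)"
    thus "mat_delete Q c c $$ (i, j) = 1\<^sub>m (n - 1) $$ (i, j)"
      using c by (auto simp: mat_delete_def Q_def)
  qed (use Q in \<open>auto simp: mat_delete_def\<close>)
  \<comment> \<open>Here the expansion runs along row \<open>c\<close>: it is zero off the diagonal,
    whereas column \<open>c\<close> of \<open>Q\<close> is filled with \<open>[:a:]\<close>.\<close>
  hence "det Q = ?x"
    using Q c by (subst det_row_single_entry[OF Q c]) (auto simp: Q_def)
  hence "det P * ?x = (?x ^ 2 - [:of_nat (n - 1) * a\<^sup>2:]) * ?x ^ (n - 1)"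
    using det_PQ det_mult[OF P Q] by simp
  \<comment> \<open>One factor \<open>?x\<close> is split off to be cancelled against
    \<open>det Q\<close>; over an integral domain this is allowed since \<open>?x\<close> is a
    nonzero polynomial.\<close>
  also have "?x ^ (n - 1) = ?x ^ (n - 2) * ?x"
    unfolding power_Suc2[symmetric] using n by (intro arg_cong[of _ _ "(^) ?x"]) simp
  finally have "det P * ?x = (?x ^ (n - 2) * (?x ^ 2 - [:of_nat (n - 1) * a\<^sup>2:])) * ?x"
    by (simp only: ac_simps)
  hence "det P = ?x ^ (n - 2) * (?x ^ 2 - [:of_nat (n - 1) * a\<^sup>2:])"
    by (subst (asm) mult_right_cancel) auto
  thus ?thesis
    by (simp add: char_poly_def P_def)
qed

text \<open>Without parallel arcs, an arc leaving \<open>v\<close> is determined by its head. This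
  lets degrees be read off from the adjacency relation.\<close>

lemma (in nomulti_digraph) out_degree_eq_card_dominated:
  "out_degree G v = card {w. v \<rightarrow>\<^bsub>G\<^esub> w}"
proof -
  have "inj_on (head G) (out_arcs G v)"
    using no_multi_arcs by (auto simp: inj_on_def arc_to_ends_def)
  moreover have "head G ` out_arcs G v = {w. v \<rightarrow>\<^bsub>G\<^esub> w}"
    by (auto simp: arcs_ends_conv)
  ultimately show ?thesis
    unfolding out_degree_def by (metis card_image)
qed

text \<open>Every arc joins the centre, of degree \<open>n - 1\<close>, and a leaf, of degree 1, so
  the product under the root is always \<open>n - 1\<close>. The index \<open>c\<close> is the
  position of the centre in \<open>vs\<close>.\<close>

lemma randic_matrix_star:
  assumes n: "n \<ge> 2" and star: "star_graph n G"
    and vs: "distinct vs" "set vs = verts G"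
  obtains c where "c < n" "randic_matrix G vs = star_mat n c (1 / sqrt (real (n - 1)))"
proof -
  from star obtain U V where UV: "verts G = U \<union> V" "U \<inter> V = {}" "card U = 1" "card V = n - 1"
      "arcs_ends G = U \<times> V \<union> V \<times> U" and "graph G"
    by (auto simp: star_graph_def complete_bipartite_digraph_def)
  then interpret graph G by simp
  obtain u where u: "U = {u}"
    using UV(3) by (auto simp: card_1_singleton_iff)
  have fin: "finite V"
    using finite_verts UV(1) by simp
  have "length vs = card (verts G)"
    using vs by (metis distinct_card)
  also have "\<dots> = n"
    using UV u fin n by simp
  finally have len: "length vs = n" .
  obtain c where c: "c < n" "vs ! c = u"
    using vs UV(1) u len by (metis in_set_conv_nth UnI1 insertI1)
  have nth_u: "vs ! i = u \<longleftrightarrow> i = c" if "i < n" for i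
    using that c vs len by (metis nth_eq_iff_index_eq)
  have nth_V: "vs ! i \<in> V \<longleftrightarrow> i \<noteq> c" if "i < n" for i
    using that nth_u[OF that] vs UV u len nth_mem[of i vs] by auto
  have adj: "vs ! i \<rightarrow>\<^bsub>G\<^esub> vs ! j \<longleftrightarrow> (i = c) \<noteq> (j = c)" if "i < n" "j < n" for i j
    using that by (auto simp: UV(5) u nth_u nth_V)
  have "{w. u \<rightarrow>\<^bsub>G\<^esub> w} = V"
    using UV u by auto
  hence deg_u: "out_degree G u = n - 1"
    using UV by (simp add: out_degree_eq_card_dominated)
  have deg_V: "out_degree G v = 1" if "v \<in> V" for v
  proof -
    have "{w. v \<rightarrow>\<^bsub>G\<^esub> w} = {u}"
      using that UV u by auto
    thus ?thesis
      by (simp add: out_degree_eq_card_dominated)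
  qed
  have "randic_matrix G vs = star_mat n c (1 / sqrt (real (n - 1)))"
  proof (rule eq_matI)
    fix i j
    assume "i < dim_row (star_mat n c (1 / sqrt (real (n - 1))))"
      "j < dim_col (star_mat n c (1 / sqrt (real (n - 1))))"
    hence ij: "i < n" "j < n"
      by (auto simp: star_mat_def)
    have deg: "out_degree G (vs ! k) = (if k = c then n - 1 else 1)" if "k < n" for k
      using that c nth_V deg_u deg_V by auto
    show "randic_matrix G vs $$ (i, j) = star_mat n c (1 / sqrt (real (n - 1))) $$ (i, j)"
      using ij by (auto simp: randic_matrix_def star_mat_def len adj deg)
  qed (auto simp: randic_matrix_def star_mat_def len)
  with c(1) show thesis
    by (rule that)
qed

theorem theorem3:
  fixes n :: nat and G :: "('a, 'b) pre_digraph" and vs :: "'a list"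
  assumes "n \<ge> 2"
    and "star_graph n G"
    and "distinct vs" and "set vs = verts G"
  shows "randic_char_poly G vs = [:0, 1:] ^ (n - 2) * ([:0, 1:] ^ 2 - 1) \<and>
         randic_energy G vs = 2"
proof
  obtain c where c: "c < n" "randic_matrix G vs = star_mat n c (1 / sqrt (real (n - 1)))"
    using randic_matrix_star[OF assms] .
  have "real (n - 1) * (1 / sqrt (real (n - 1)))\<^sup>2 = 1"
    using assms(1) by (simp add: power_divide)
  thus poly: "randic_char_poly G vs = [:0, 1:] ^ (n - 2) * ([:0, 1:] ^ 2 - 1)"
    unfolding randic_char_poly_def c(2) char_poly_star_mat[OF assms(1) c(1)]
    by (simp only: one_pCons)
  let ?p = "[:0, 1:] ^ (n - 2) * ([:0, 1:] ^ 2 - 1) :: real poly"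
  have ev: "eigenvalue (randic_matrix G vs) r \<longleftrightarrow> poly ?p r = 0" for r
    using eigenvalue_root_char_poly[of "randic_matrix G vs" "length vs" r] poly
    by (simp add: randic_char_poly_def randic_matrix_def)
  \<comment> \<open>The value at 2 is \<open>2 ^ (n - 2) * 3\<close>; any point other than 0, 1 and
    -1 would do.\<close>
  have "poly ?p 2 \<noteq> 0"
    by simp
  hence nz: "?p \<noteq> 0"
    by (metis poly_0)
  \<comment> \<open>Since \<open>r\<^sup>2 = 1\<close>, the quadratic factor splits as (x - r)(x +
    r). The cofactor of x - r takes the value \<open>r ^ (n - 2) * (2 * r)\<close> at
    \<open>r\<close>, which is nonzero, so the root is simple.\<close>
  have order: "order r ?p = 1" if "r = 1 \<or> r = -1" for r :: real
  proof -
    have factor: "?p = [:- r, 1:] ^ 1 * ([:0, 1:] ^ (n - 2) * [:r, 1:])"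
      using that by (auto simp: power2_eq_square one_pCons)
    have "order r ([:0, 1:] ^ (n - 2) * [:r, 1:]) = 0"
      using that by (intro order_0I) auto
    thus ?thesis
      using nz unfolding factor by (subst order_mult) (auto simp only: order_power_n_n)
  qed
  have "randic_energy G vs = (\<Sum>r | poly ?p r = 0. real (order r ?p) * \<bar>r\<bar>)"
    by (simp only: randic_energy_def ev poly)
  \<comment> \<open>The only other possible root is 0, present when n > 2; whatever its
    multiplicity, it contributes nothing to the energy.\<close>
  also have "\<dots> = (\<Sum>r\<in>{1, -1}. real (order r ?p) * \<bar>r\<bar>)"
    using nz by (intro sum.mono_neutral_right poly_roots_finite) (auto simp: power2_eq_1_iff)
  also have "\<dots> = 2"
    by (simp add: order del: One_nat_def)
  finally show "randic_energy G vs = 2" .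
qed

end
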